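(* Consider $R\sim\mathcal{M}(F)$ with $F\in\mathbb{R}^{3\times3}$ and the unscented transform $\Sigma(F)$ of $\mathcal{M}(F)$, consisting of the sigma points $R_0$, $R_i(\theta_i)$, $R_i(-\theta_i)$ with weights $w_0$, $w_i$, $w_i$, respectively, for $i\in\{1,2,3\}$ (as defined in the context). The (weighted) first moment of the sigma points $\Sigma(F)$ is equal to that of $\mathcal{M}(F)$, i.e., $$\sum_{(\tilde R,\tilde w)\in\Sigma(F)}\tilde w\tilde R=\mathrm{E}[R],$$ where the left-hand side is $w_0R_0+\sum_{i=1}^3w_i\{R_i(\theta_i)+R_i(-\theta_i)\}$.
   Context: $\mathsf{SO(3)}=\{R\in\mathbb{R}^{3\times3}\mid R^TR=I_{3\times3},\det R=1\}$ carries the Haar measure $dR$ normalized by $\int_{\mathsf{SO(3)}}dR=1$. For $F\in\mathbb{R}^{3\times3}$, $R\sim\mathcal{M}(F)$ (matrix Fisher distribution) means that $R\in\mathsf{SO(3)}$ has density $p(R)=\frac{1}{c(F)}\exp(\mathrm{tr}[F^TR])$ with respect to $dR$, where $c(F)=\int_{\mathsf{SO(3)}}\exp(\mathrm{tr}[F^TR])\,dR$. The first moment $\mathrm{E}[R]$ is the arithmetic (entrywise) mean of $R$. For diagonal $S=\mathrm{diag}[s_1,s_2,s_3]$, $c(S)$ is regarded as a function of $(s_1,s_2,s_3)\in\mathbb{R}^3$ when taking partial derivatives. $\mathcal{I}=\{(1,2,3),(2,3,1),(3,1,2)\}$; $e_i$ are the standard basis vectors of $\mathbb{R}^3$; $\hat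 x$ is the skew-symmetric matrix with $\hat xy=x\times y$. Proper singular value decomposition: let $F=U'S'(V')^T$ be a singular value decomposition with $U',V'$ orthogonal and $S'=\mathrm{diag}[s_1',s_2',s_3']$, $s_1'\ge s_2'\ge s_3'\ge0$. The proper singular value decomposition is $F=USV^T$ with $U=U'\mathrm{diag}[1,1,\det U']\in\mathsf{SO(3)}$, $V=V'\mathrm{diag}[1,1,\det V']\in\mathsf{SO(3)}$, $S=\mathrm{diag}[s_1,s_2,s_3]=\mathrm{diag}[s_1',s_2',\det[U'V']s_3']$. Unscented transform: the seven sigma points are $R_0=UV^T$ and $R_i(\theta_i),R_i(-\theta_i)$, $i\in\{1,2,3\}$, where $R_i(\theta)=U\exp(\theta\hat e_i)V^T$ and $0<\theta_i<\pi$ is defined, for $(i,j,k)\in\mathcal{I}$, by $$\cos\theta_i=\begin{cases}\sigma+\dfrac{(1-\sigma)(\log c(S)-s_i)}{s_j+s_k}&\text{if }s_j+s_k\ge1,\\[2mm]\{\sigma+(1-\sigma)(\log c(S)-s_i)+\frac12\}(s_j+s_k)-\frac12&\text{else if }0\le s_j+s_k<1,\end{cases}$$ with a parameter $\sigma$ satisfying $$0\le\max\left\{\frac{2s_1+s_2-s_3-1}{2s_1+s_2-s_3+1},\ \frac{s_1-s_3}{s_1+s_2}\right\}<\sigma<1.$$ The weight of each of $R_i(\theta_i)$ and $R_i(-\theta_i)$ is, for $(i,j,k)\in\mathcal{I}$, $$w_i=\frac{1}{4(1-\cos\theta_i)}\left\{\frac{1}{c(S)}\left(\frac{\partial c(S)}{\partial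 s_i}-\frac{\partial c(S)}{\partial s_j}-\frac{\partial c(S)}{\partial s_k}\right)+1\right\},$$ and the weight of $R_0$ is $w_0=1-2\sum_{i=1}^3w_i$. $\Sigma(F)$ is the collection of these seven (sigma point, weight) pairs. *)

theory Defs
  imports "HOL-Probability.Probability"
begin

definition SO3 :: "(real^3^3) set" where
  "SO3 = {R. rotation_matrix R}"

(* Left invariance and total mass 1 determine the measure uniquely; since SO(3) is compact,
   right invariance is a consequence and is not part of the definition. *)
definition is_haar_SO3 :: "(real^3^3) measure \<Rightarrow> bool" where
  "is_haar_SO3 \<mu> \<longleftrightarrow>
     sets \<mu> = sets (restrict_space borel SO3) \<and> prob_space \<mu> \<and>
     (\<forall>Q\<in>SO3. \<forall>A\<in>sets \<mu>. emeasure \<mu> ((\<lambda>R. Q ** R) ` A) = emeasure \<mu> A)"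

definition fisher_const :: "(real^3^3) measure \<Rightarrow> real^3^3 \<Rightarrow> real" where
  "fisher_const \<mu> F = (\<integral>R. exp (trace (transpose F ** R)) \<partial>\<mu>)"

definition matrix_fisher ::
  "(real^3^3) measure \<Rightarrow> 'a measure \<Rightarrow> ('a \<Rightarrow> real^3^3) \<Rightarrow> real^3^3 \<Rightarrow> bool" where
  "matrix_fisher \<mu> P X F \<longleftrightarrow> prob_space P \<and>
     distributed P \<mu> X (\<lambda>R. ennreal (1 / fisher_const \<mu> F * exp (trace (transpose F ** R))))"

definition first_moment :: "'a measure \<Rightarrow> ('a \<Rightarrow> real^3^3) \<Rightarrow> real^3^3" where
  "first_moment P X = (\<chi> i j. \<integral>\<omega>. X \<omega> $ i $ j \<partial>P)"

definition diag3 :: "real^3 \<Rightarrow> real^3^3" where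
  "diag3 s = (\<chi> i j. if i = j then s $ i else 0)"

definition proper_svd :: "real^3^3 \<Rightarrow> real^3^3 \<Rightarrow> real^3 \<Rightarrow> real^3^3 \<Rightarrow> bool" where
  "proper_svd F U s V \<longleftrightarrow>
     (\<exists>U' s' V'. orthogonal_matrix U' \<and> orthogonal_matrix V' \<and>
        s' $ 1 \<ge> s' $ 2 \<and> s' $ 2 \<ge> s' $ 3 \<and> s' $ 3 \<ge> 0 \<and>
        F = U' ** diag3 s' ** transpose V' \<and>
        U = U' ** diag3 (vector [1, 1, det U']) \<and>
        V = V' ** diag3 (vector [1, 1, det V']) \<and>
        s = vector [s' $ 1, s' $ 2, det (U' ** V') * s' $ 3])"

definition partial_deriv :: "3 \<Rightarrow> (real^3 \<Rightarrow> real) \<Rightarrow> real^3 \<Rightarrow> real" where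
  "partial_deriv i f s = deriv (\<lambda>t. f (\<chi> m. if m = i then t else s $ m)) (s $ i)"

definition hat :: "real^3 \<Rightarrow> real^3^3" where
  "hat x = matrix (\<lambda>y. cross3 x y)"

(* The library's exp cannot be used: real^3^3 is not a normed algebra under matrix
   multiplication. *)
definition mat_exp :: "real^3^3 \<Rightarrow> real^3^3" where
  "mat_exp A = (\<Sum>n. ((\<lambda>B. A ** B) ^^ n) (mat 1) /\<^sub>R fact n)"

definition cyclic_triples :: "(3 \<times> 3 \<times> 3) set" where
  "cyclic_triples = {(1, 2, 3), (2, 3, 1), (3, 1, 2)}"

(* For F = 0 the second quotient is 0/0, which is 0 in HOL; the condition is then
   0 < \<sigma> < 1. *)
definition ut_parameter :: "real^3 \<Rightarrow> real \<Rightarrow> bool" where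
  "ut_parameter s \<sigma> \<longleftrightarrow>
     (let m = max ((2 * s $ 1 + s $ 2 - s $ 3 - 1) / (2 * s $ 1 + s $ 2 - s $ 3 + 1))
                  ((s $ 1 - s $ 3) / (s $ 1 + s $ 2))
      in 0 \<le> m \<and> m < \<sigma> \<and> \<sigma> < 1)"

(* In a proper singular value decomposition s_j + s_k \<ge> 0 for all j \<noteq> k, so the two
   cases below are exhaustive. *)
definition ut_angles :: "(real^3^3) measure \<Rightarrow> real^3 \<Rightarrow> real \<Rightarrow> (3 \<Rightarrow> real) \<Rightarrow> bool" where
  "ut_angles \<mu> s \<sigma> \<theta> \<longleftrightarrow>
     (\<forall>(i, j, k)\<in>cyclic_triples. 0 < \<theta> i \<and> \<theta> i < pi \<and>
        (s $ j + s $ k \<ge> 1 \<longrightarrow>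
           cos (\<theta> i) = \<sigma> + (1 - \<sigma>) * (ln (fisher_const \<mu> (diag3 s)) - s $ i) / (s $ j + s $ k)) \<and>
        (0 \<le> s $ j + s $ k \<and> s $ j + s $ k < 1 \<longrightarrow>
           cos (\<theta> i) =
             (\<sigma> + (1 - \<sigma>) * (ln (fisher_const \<mu> (diag3 s)) - s $ i) + 1 / 2) * (s $ j + s $ k) - 1 / 2))"

definition ut_weight ::
  "(real^3^3) measure \<Rightarrow> real^3 \<Rightarrow> (3 \<Rightarrow> real) \<Rightarrow> 3 \<times> 3 \<times> 3 \<Rightarrow> real" where
  "ut_weight \<mu> s \<theta> = (\<lambda>(i, j, k).
     let c = (\<lambda>s. fisher_const \<mu> (diag3 s)) in
       1 / (4 * (1 - cos (\<theta> i))) *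
         (1 / c s * (partial_deriv i c s - partial_deriv j c s - partial_deriv k c s) + 1))"

definition sigma_point :: "real^3^3 \<Rightarrow> real^3^3 \<Rightarrow> 3 \<Rightarrow> real \<Rightarrow> real^3^3" where
  "sigma_point U V i t = U ** mat_exp (t *\<^sub>R hat (axis i 1)) ** transpose V"

definition unscented_transform ::
  "(real^3^3) measure \<Rightarrow> real^3^3 \<Rightarrow> real^3 \<Rightarrow> real^3^3 \<Rightarrow> (3 \<Rightarrow> real) \<Rightarrow>
   ((real^3^3) \<times> real) list" where
  "unscented_transform \<mu> U s V \<theta> =
     (let w1 = ut_weight \<mu> s \<theta> (1, 2, 3);
          w2 = ut_weight \<mu> s \<theta> (2, 3, 1);
          w3 = ut_weight \<mu> s \<theta> (3, 1, 2);
          w0 = 1 - 2 * (w1 + w2 + w3)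
      in [(U ** transpose V, w0),
          (sigma_point U V 1 (\<theta> 1), w1), (sigma_point U V 1 (- \<theta> 1), w1),
          (sigma_point U V 2 (\<theta> 2), w2), (sigma_point U V 2 (- \<theta> 2), w2),
          (sigma_point U V 3 (\<theta> 3), w3), (sigma_point U V 3 (- \<theta> 3), w3)])"

end

theory Submission
  imports Defs
begin

text \<open>
  Both sides of the claim have the form \<open>U D V\<^sup>T\<close> with the same diagonal
  matrix \<open>D\<close>, whose entries are the logarithmic derivatives
  \<open>(\<partial>c / \<partial>s\<^sub>i) / c(S)\<close>.

  For the distribution, let \<open>M(F)\<close> be the integral of \<open>exp (tr (F\<^sup>T R)) R\<close> over the
  rotation group, so that \<open>E[R] = M(F) / c(F)\<close>.  The substitution \<open>R = U Q V\<^sup>T\<close>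
  turns \<open>tr (F\<^sup>T R)\<close> into \<open>tr (S Q)\<close>, whence \<open>c(F) = c(S)\<close> and
  \<open>M(F) = U M(S) V\<^sup>T\<close> (\<open>fisher_moment_svd\<close>).  This needs the Haar measure to be invariant
  from both sides, which holds because left Haar measure of total mass one is preserved by
  inversion (\<open>distr_transpose\<close>).  Conjugating with a diagonal rotation with entries \<open>\<plusminus>1\<close> fixes
  \<open>S\<close> but changes the sign of off-diagonal entries, so \<open>M(S)\<close> is diagonal
  (\<open>fisher_moment_off_diagonal\<close>); and since
  \<open>\<partial>/\<partial>s\<^sub>i exp (tr (S R)) = exp (tr (S R)) R\<^sub>i\<^sub>i\<close>, differentiation under the integral
  identifies its diagonal with the gradient of \<open>c\<close> (\<open>partial_deriv_fisher_const\<close>).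

  For the sigma points, Rodrigues' formula shows that the sines cancel in
  \<open>R\<^sub>i(\<theta>) + R\<^sub>i(-\<theta>)\<close>, which is therefore \<open>U D' V\<^sup>T\<close> with \<open>D'\<close> diagonal: \<open>2\<close> in
  position \<open>i\<close> and \<open>2 cos \<theta>\<close> elsewhere (\<open>mat_exp_hat_pair\<close>).  As the seven weights add up to
  one, the weighted sum has the \<open>m\<close>-th diagonal entry
  \<open>1 - 2 \<Sum>\<^sub>i w\<^sub>i (1 - cos \<theta>\<^sub>i)\<close>, summed over the two indices \<open>i \<noteq> m\<close>.  The weights
  are defined so that \<open>w\<^sub>i (1 - cos \<theta>\<^sub>i)\<close> is a linear combination of the three
  logarithmic derivatives, and in this sum all of them except the \<open>m\<close>-th cancel.
\<close>

section \<open>Rotations and diagonal matrices\<close>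

lemma SO3_iff: "R \<in> SO3 \<longleftrightarrow> orthogonal_matrix R \<and> det R = 1"
  by (simp add: SO3_def rotation_matrix_def)

lemma SO3_mult: "A \<in> SO3 \<Longrightarrow> B \<in> SO3 \<Longrightarrow> A ** B \<in> SO3"
  by (simp add: SO3_iff orthogonal_matrix_mul det_mul)

lemma SO3_transpose: "A \<in> SO3 \<Longrightarrow> transpose A \<in> SO3"
  by (simp add: SO3_iff)

lemma SO3_inverse:
  assumes "Q \<in> SO3"
  shows "transpose Q ** Q = mat 1" "Q ** transpose Q = mat 1"
    "transpose Q ** (Q ** R) = R" "Q ** (transpose Q ** R) = R"
proof -
  show 1: "transpose Q ** Q = mat 1" "Q ** transpose Q = mat 1"
    using assms by (auto simp: SO3_iff orthogonal_matrix_def)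
  show "transpose Q ** (Q ** R) = R" "Q ** (transpose Q ** R) = R"
    by (simp_all add: matrix_mul_assoc 1)
qed

lemma continuous_on_matrix_mult [continuous_intros]:
  fixes f g :: "'t::topological_space \<Rightarrow> real^3^3"
  assumes "continuous_on A f" "continuous_on A g"
  shows "continuous_on A (\<lambda>x. f x ** g x)"
  unfolding matrix_matrix_mult_def by (intro continuous_intros assms)

lemma continuous_on_transpose [continuous_intros]:
  fixes f :: "'t::topological_space \<Rightarrow> real^3^3"
  assumes "continuous_on A f"
  shows "continuous_on A (\<lambda>x. transpose (f x))"
  unfolding transpose_def by (intro continuous_intros assms)

lemma continuous_on_trace [continuous_intros]:
  fixes f :: "'t::topological_space \<Rightarrow> real^3^3"
  assumes "continuous_on A f"
  shows "continuous_on A (\<lambda>x. trace (f x))"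
  unfolding trace_def by (intro continuous_intros assms)

lemma compact_SO3: "compact SO3"
proof -
  have eq: "SO3 = {R. transpose R ** R = mat 1} \<inter> {R. det R = 1}"
    by (auto simp: SO3_iff orthogonal_matrix)
  have "closed SO3"
    unfolding eq det_3
    by (intro closed_Int closed_Collect_eq continuous_intros)
  moreover have "bounded SO3"
  proof (rule boundedI)
    fix R :: "real^3^3" assume "R \<in> SO3"
    then have "norm (row i R) = 1" for i
      by (auto simp: SO3_iff orthogonal_matrix_orthonormal_rows)
    then have "norm (R $ i) = 1" for i
      by (simp add: row_def vec_lambda_eta)
    then show "norm R \<le> 3"
      using L2_set_le_sum[of UNIV "\<lambda>i. norm (R $ i)"] by (simp add: norm_vec_def)
  qed
  ultimately show ?thesis by (simp add: compact_eq_bounded_closed)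
qed

lemma SO3_entry_le_1:
  assumes "R \<in> SO3"
  shows "\<bar>R $ i $ j\<bar> \<le> 1"
proof -
  have "norm (row i R) = 1"
    using assms by (auto simp: SO3_iff orthogonal_matrix_orthonormal_rows)
  then show ?thesis
    using component_le_norm_cart[of "row i R" j] by (simp add: row_def)
qed

lemma linear_mult_both: "linear (\<lambda>M::real^3^3. A ** M ** B)"
proof (rule linearI)
  fix M N :: "real^3^3" and r :: real
  show "A ** (M + N) ** B = A ** M ** B + A ** N ** B"
    by (simp add: matrix_matrix_mult_def vec_eq_iff sum_3 algebra_simps)
  show "A ** (r *\<^sub>R M) ** B = r *\<^sub>R (A ** M ** B)"
    by (simp add: matrix_scalar_ac scalar_matrix_assoc)
qed

text \<open>
  The exponent of the Fisher density is invariant under the simultaneous substitution in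
  parameter and rotation.
\<close>
lemma trace_conjugated:
  assumes "U \<in> SO3" "V \<in> SO3"
  shows "trace (transpose (U ** S ** transpose V) ** (U ** R ** transpose V))
    = trace (transpose S ** R)"
proof -
  have "transpose (U ** S ** transpose V) ** (U ** R ** transpose V)
      = V ** (transpose S ** (transpose U ** (U ** (R ** transpose V))))"
    by (simp add: matrix_transpose_mul matrix_mul_assoc)
  also have "\<dots> = V ** (transpose S ** R ** transpose V)"
    by (simp add: SO3_inverse assms matrix_mul_assoc[symmetric])
  finally show ?thesis
    using SO3_inverse(1)[OF assms(2)]
    by (simp add: trace_mul_sym[of V] matrix_mul_assoc[symmetric])
qed

lemma diag3_mult: "diag3 a ** diag3 b = diag3 (\<chi> i. a $ i * b $ i)"
  by (simp add: diag3_def matrix_matrix_mult_def vec_eq_iff sum_3 forall_3)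

lemma transpose_diag3: "transpose (diag3 a) = diag3 a"
  by (simp add: diag3_def transpose_def vec_eq_iff)

lemma mat_1_diag3: "mat 1 = diag3 (\<chi> i. 1)"
  by (simp add: diag3_def mat_def vec_eq_iff)

lemma diag3_eq_iff: "diag3 a = diag3 b \<longleftrightarrow> (\<forall>i. a $ i = b $ i)"
  by (auto simp: diag3_def vec_eq_iff)

lemma orthogonal_diag3: "orthogonal_matrix (diag3 d) \<longleftrightarrow> (\<forall>i. d $ i * d $ i = 1)"
  by (simp add: orthogonal_matrix transpose_diag3 diag3_mult mat_1_diag3 diag3_eq_iff)

lemma det_diag3: "det (diag3 a) = a $ 1 * a $ 2 * a $ 3"
  by (simp add: det_3 diag3_def)

lemma diag3_mult_both_nth: "(diag3 a ** M ** diag3 b) $ i $ j = a $ i * M $ i $ j * b $ j"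
  using exhaust_3[of i] exhaust_3[of j]
  by (auto simp: diag3_def matrix_matrix_mult_def sum_3)

lemma trace_diag3: "trace (transpose (diag3 a) ** R) = (\<Sum>i\<in>UNIV. a $ i * R $ i $ i)"
  unfolding transpose_diag3 by (simp add: trace_def diag3_def matrix_matrix_mult_def sum_3)

text \<open>
  The sign corrections of \<open>U'\<close> and \<open>V'\<close> each square to one, so the determinant factor in the
  third singular value compensates for them and the product \<open>F\<close> is unchanged.
\<close>
lemma proper_svd_SO3:
  assumes "proper_svd F U s V"
  shows "U \<in> SO3" "V \<in> SO3" "F = U ** diag3 s ** transpose V"
proof -
  obtain U' s' V' where o: "orthogonal_matrix U'" "orthogonal_matrix V'"
    and F: "F = U' ** diag3 s' ** transpose V'"
    and U: "U = U' ** diag3 (vector [1, 1, det U'])"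
    and V: "V = V' ** diag3 (vector [1, 1, det V'])"
    and s: "s = vector [s' $ 1, s' $ 2, det (U' ** V') * s' $ 3]"
    using assms by (auto simp: proper_svd_def)
  have det1: "det U' * det U' = 1" "det V' * det V' = 1"
    using det_orthogonal_matrix[OF o(1)] det_orthogonal_matrix[OF o(2)] by auto
  have sign: "orthogonal_matrix (diag3 (vector [1, 1, d]))" if "d * d = 1" for d
    using that by (simp add: orthogonal_diag3 forall_3)
  show "U \<in> SO3" "V \<in> SO3"
    using o det1 sign by (auto simp: U V SO3_iff orthogonal_matrix_mul det_mul det_diag3)
  have "diag3 (vector [1, 1, det U']) ** diag3 s ** diag3 (vector [1, 1, det V']) = diag3 s'"
    using det1 by (simp add: diag3_mult s det_mul diag3_eq_iff forall_3)
  then show "F = U ** diag3 s ** transpose V"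
    unfolding F U V matrix_transpose_mul transpose_diag3 by (metis matrix_mul_assoc)
qed

section \<open>Two-sided invariance of the Haar measure\<close>

locale haar_SO3 =
  fixes \<mu> :: "(real^3^3) measure"
  assumes haar: "is_haar_SO3 \<mu>"
begin

sublocale prob_space \<mu> using haar by (simp add: is_haar_SO3_def)

lemma sets_haar: "sets \<mu> = sets (restrict_space borel SO3)"
  using haar by (simp add: is_haar_SO3_def)

lemma space_haar: "space \<mu> = SO3"
  using sets_eq_imp_space_eq[OF sets_haar] by (simp add: space_restrict_space)

lemma measurable_continuous:
  assumes "continuous_on UNIV g"
  shows "g \<in> borel_measurable \<mu>"
  using measurable_restrict_space1[OF borel_measurable_continuous_onI[OF assms]]
    measurable_cong_sets[OF sets_haar refl] by blast

lemma measurable_into_SO3: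
  assumes "f \<in> borel_measurable N" "\<And>x. x \<in> space N \<Longrightarrow> f x \<in> SO3"
  shows "f \<in> measurable N \<mu>"
  using measurable_restrict_space2[of f N SO3 borel] assms
    measurable_cong_sets[OF refl sets_haar] by blast

lemma integrable_continuous:
  fixes g :: "real^3^3 \<Rightarrow> 'b::{banach, second_countable_topology}"
  assumes "continuous_on UNIV g"
  shows "integrable \<mu> g"
proof -
  have "bounded (g ` SO3)"
    by (intro compact_imp_bounded compact_continuous_image compact_SO3
        continuous_on_subset[OF assms]) auto
  then obtain B where "\<And>x. x \<in> SO3 \<Longrightarrow> norm (g x) \<le> B"
    by (auto simp: bounded_iff)
  then show ?thesis
    by (intro integrable_const_bound[where B = B] AE_I2 measurable_continuous assms)
       (simp add: space_haar)
qed

lemma mult_measurable: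
  "(\<lambda>p. fst p ** snd p) \<in> measurable (\<mu> \<Otimes>\<^sub>M \<mu>) \<mu>"
proof (rule measurable_into_SO3)
  have id: "(\<lambda>x. x) \<in> borel_measurable \<mu>"
    by (intro measurable_continuous continuous_intros)
  show "(\<lambda>p. fst p ** snd p) \<in> borel_measurable (\<mu> \<Otimes>\<^sub>M \<mu>)"
  proof (rule borel_measurable_continuous_Pair[of fst _ snd "(**)"])
    show "fst \<in> borel_measurable (\<mu> \<Otimes>\<^sub>M \<mu>)"
      using measurable_compose[OF measurable_fst id] .
    show "snd \<in> borel_measurable (\<mu> \<Otimes>\<^sub>M \<mu>)"
      using measurable_compose[OF measurable_snd id] .
  qed (intro continuous_intros)
qed (auto simp: space_pair_measure space_haar SO3_mult)

lemma left_mult_measurable: "Q \<in> SO3 \<Longrightarrow> (\<lambda>R. Q ** R) \<in> measurable \<mu> \<mu>"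
  by (intro measurable_into_SO3 measurable_continuous continuous_intros)
     (auto simp: space_haar SO3_mult)

lemma transpose_measurable: "transpose \<in> measurable \<mu> \<mu>"
  by (intro measurable_into_SO3 measurable_continuous continuous_intros)
     (auto simp: space_haar SO3_transpose)

text \<open>
  The definition of Haar measure speaks of images of sets; the preimage under translation by
  \<open>Q\<close> is the image under translation by \<open>Q\<^sup>T\<close>.
\<close>
lemma distr_left_mult:
  assumes Q: "Q \<in> SO3"
  shows "distr \<mu> \<mu> (\<lambda>R. Q ** R) = \<mu>"
proof (rule measure_eqI)
  fix A assume "A \<in> sets (distr \<mu> \<mu> (\<lambda>R. Q ** R))"
  then have A: "A \<in> sets \<mu>" by simp
  then have sub: "A \<subseteq> SO3" using sets.sets_into_space space_haar by blast
  have "(\<lambda>R. Q ** R) -` A \<inter> space \<mu> = (\<lambda>R. transpose Q ** R) ` A"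
  proof safe
    fix R assume "Q ** R \<in> A"
    then show "R \<in> (\<lambda>R. transpose Q ** R) ` A"
      using SO3_inverse(3)[OF Q, of R] by (metis image_eqI)
  next
    fix R assume "R \<in> A"
    then show "transpose Q ** R \<in> space \<mu>"
      using sub by (auto simp: space_haar intro!: SO3_mult SO3_transpose Q)
  qed (simp add: SO3_inverse[OF Q])
  then show "emeasure (distr \<mu> \<mu> (\<lambda>R. Q ** R)) A = emeasure \<mu> A"
    using haar A SO3_transpose[OF Q]
    by (simp add: emeasure_distr left_mult_measurable Q is_haar_SO3_def)
qed simp

text \<open>
  A compact group is unimodular.  The function \<open>(y, x) \<mapsto> indicator A (y\<^sup>T x)\<close> is integrated in
  both orders: for fixed \<open>y\<close>, left invariance gives the measure of \<open>A\<close>; for fixed \<open>x\<close>, the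
  argument is the inverse of \<open>x\<^sup>T y\<close>, and left invariance gives the measure of the inverse of \<open>A\<close>.
\<close>
lemma distr_transpose: "distr \<mu> \<mu> transpose = \<mu>"
proof (rule measure_eqI)
  fix A assume "A \<in> sets (distr \<mu> \<mu> transpose)"
  then have A: "A \<in> sets \<mu>" by simp
  interpret P: pair_sigma_finite \<mu> \<mu> ..
  note [measurable] = A transpose_measurable
  have tm: "(\<lambda>p. (transpose (fst p) ** snd p)) \<in> measurable (\<mu> \<Otimes>\<^sub>M \<mu>) \<mu>"
    using measurable_compose[of "\<lambda>p. (transpose (fst p), snd p)" "\<mu> \<Otimes>\<^sub>M \<mu>" "\<mu> \<Otimes>\<^sub>M \<mu>", OF _ mult_measurable]
    by simp
  have ind: "(\<lambda>p. indicator A (transpose (fst p) ** snd p) :: ennreal) \<in> borel_measurable (\<mu> \<Otimes>\<^sub>M \<mu>)"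
    using measurable_compose[OF tm borel_measurable_indicator[OF A]] .
  have left: "(\<integral>\<^sup>+x. indicator A (Q ** x) \<partial>\<mu>) = emeasure \<mu> A" if "Q \<in> SO3" for Q
  proof -
    have "emeasure \<mu> A = (\<integral>\<^sup>+x. indicator A x \<partial>distr \<mu> \<mu> (\<lambda>R. Q ** R))"
      using A by (simp add: distr_left_mult[OF that])
    also have "\<dots> = (\<integral>\<^sup>+x. indicator A (Q ** x) \<partial>\<mu>)"
      by (rule nn_integral_distr) (simp_all add: left_mult_measurable that)
    finally show ?thesis ..
  qed
  have right: "(\<integral>\<^sup>+y. indicator A (transpose y ** x) \<partial>\<mu>) = emeasure (distr \<mu> \<mu> transpose) A"
    if x: "x \<in> SO3" for x
  proof -
    have "(\<integral>\<^sup>+y. indicator A (transpose y ** x) \<partial>\<mu>)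
        = (\<integral>\<^sup>+y. indicator A (transpose (transpose x ** y)) \<partial>\<mu>)"
      by (simp add: matrix_transpose_mul)
    also have "\<dots> = (\<integral>\<^sup>+y. indicator A (transpose y) \<partial>distr \<mu> \<mu> (\<lambda>R. transpose x ** R))"
      by (rule nn_integral_distr[symmetric])
         (simp_all add: left_mult_measurable SO3_transpose x)
    also have "\<dots> = (\<integral>\<^sup>+y. indicator A (transpose y) \<partial>\<mu>)"
      by (simp add: distr_left_mult SO3_transpose x)
    also have "\<dots> = (\<integral>\<^sup>+y. indicator A y \<partial>distr \<mu> \<mu> transpose)"
      by (rule nn_integral_distr[symmetric]) simp_all
    finally show ?thesis using A by simp
  qed
  have "emeasure \<mu> A = (\<integral>\<^sup>+y. emeasure \<mu> A \<partial>\<mu>)"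
    by (simp add: emeasure_space_1)
  also have "\<dots> = (\<integral>\<^sup>+y. \<integral>\<^sup>+x. indicator A (transpose y ** x) \<partial>\<mu> \<partial>\<mu>)"
    by (intro nn_integral_cong) (simp add: left space_haar SO3_transpose)
  also have "\<dots> = (\<integral>\<^sup>+x. \<integral>\<^sup>+y. indicator A (transpose y ** x) \<partial>\<mu> \<partial>\<mu>)"
    using P.Fubini[OF ind] by simp
  also have "\<dots> = (\<integral>\<^sup>+x. emeasure (distr \<mu> \<mu> transpose) A \<partial>\<mu>)"
    by (intro nn_integral_cong) (simp add: right space_haar)
  also have "\<dots> = emeasure (distr \<mu> \<mu> transpose) A"
    by (simp add: emeasure_space_1)
  finally show "emeasure (distr \<mu> \<mu> transpose) A = emeasure \<mu> A" ..
qed simp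

lemma integral_left_mult:
  fixes g :: "real^3^3 \<Rightarrow> 'b::{banach, second_countable_topology}"
  assumes "continuous_on UNIV g" "Q \<in> SO3"
  shows "(\<integral>R. g (Q ** R) \<partial>\<mu>) = (\<integral>R. g R \<partial>\<mu>)"
  using integral_distr[OF left_mult_measurable measurable_continuous, of Q g] assms
  by (simp add: distr_left_mult)

lemma integral_transpose:
  fixes g :: "real^3^3 \<Rightarrow> 'b::{banach, second_countable_topology}"
  assumes "continuous_on UNIV g"
  shows "(\<integral>R. g (transpose R) \<partial>\<mu>) = (\<integral>R. g R \<partial>\<mu>)"
  using integral_distr[OF transpose_measurable measurable_continuous, of g] assms
  by (simp add: distr_transpose)

text \<open>Right translation is left translation conjugated by inversion.\<close>
lemma integral_both_mult:
  fixes g :: "real^3^3 \<Rightarrow> 'b::{banach, second_countable_topology}"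
  assumes g: "continuous_on UNIV g" and A: "A \<in> SO3" and B: "B \<in> SO3"
  shows "(\<integral>R. g (A ** R ** B) \<partial>\<mu>) = (\<integral>R. g R \<partial>\<mu>)"
proof -
  have cont: "continuous_on UNIV (\<lambda>R. g (h R))" if "continuous_on UNIV h" for h :: "real^3^3 \<Rightarrow> real^3^3"
    using continuous_on_compose2[OF g that] by simp
  have "(\<integral>R. g (A ** R ** B) \<partial>\<mu>) = (\<integral>R. g (A ** (R ** B)) \<partial>\<mu>)"
    by (simp add: matrix_mul_assoc)
  also have "\<dots> = (\<integral>R. g (A ** (transpose R ** B)) \<partial>\<mu>)"
    by (rule integral_transpose[symmetric]) (intro cont continuous_intros)
  also have "\<dots> = (\<integral>R. g (A ** transpose (transpose B ** R)) \<partial>\<mu>)"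
    by (simp add: matrix_transpose_mul)
  also have "\<dots> = (\<integral>R. g (A ** transpose R) \<partial>\<mu>)"
    by (rule integral_left_mult) (intro cont continuous_intros SO3_transpose B)+
  also have "\<dots> = (\<integral>R. g (A ** R) \<partial>\<mu>)"
    by (rule integral_transpose) (intro cont continuous_intros)
  also have "\<dots> = (\<integral>R. g R \<partial>\<mu>)"
    by (rule integral_left_mult) (intro g A)+
  finally show ?thesis .
qed


end

section \<open>The first moment of the matrix Fisher distribution\<close>

text \<open>The bound behind the dominating function for the difference quotients below.\<close>
lemma abs_exp_minus_one_le:
  fixes u :: real
  shows "\<bar>exp u - 1\<bar> \<le> \<bar>u\<bar> * exp \<bar>u\<bar>"
proof -
  have lower: "u \<le> exp u - 1"
    using exp_ge_add_one_self[of u] by linarith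
  have "(1 - u) * exp u \<le> exp (- u) * exp u"
    using exp_ge_add_one_self[of "- u"] by (intro mult_right_mono) auto
  then have upper: "exp u - 1 \<le> u * exp u"
    by (simp add: exp_minus algebra_simps)
  show ?thesis
  proof (cases "0 \<le> u")
    case True
    then show ?thesis using lower upper by simp
  next
    case False
    then have "\<bar>exp u - 1\<bar> \<le> \<bar>u\<bar> * 1" using lower by simp
    also have "\<dots> \<le> \<bar>u\<bar> * exp \<bar>u\<bar>" by (intro mult_left_mono) auto
    finally show ?thesis .
  qed
qed

context haar_SO3
begin

lemma fisher_const_svd:
  assumes "U \<in> SO3" "V \<in> SO3"
  shows "fisher_const \<mu> (U ** S ** transpose V) = fisher_const \<mu> S"
proof -
  have "(\<integral>R. exp (trace (transpose (U ** S ** transpose V) ** (U ** R ** transpose V))) \<partial>\<mu>)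
      = fisher_const \<mu> (U ** S ** transpose V)"
    unfolding fisher_const_def
    by (rule integral_both_mult) (intro continuous_intros assms SO3_transpose)+
  then show ?thesis
    by (simp add: trace_conjugated assms fisher_const_def)
qed

text \<open>Integrating a matrix-valued function lets linear substitutions pass through the integral at once.\<close>
definition fisher_moment :: "real^3^3 \<Rightarrow> real^3^3" where
  "fisher_moment F = (\<integral>R. exp (trace (transpose F ** R)) *\<^sub>R R \<partial>\<mu>)"

lemma integrable_fisher_moment: "integrable \<mu> (\<lambda>R. exp (trace (transpose F ** R)) *\<^sub>R R)"
  by (intro integrable_continuous continuous_intros)

lemma fisher_moment_nth:
  "fisher_moment F $ i $ j = (\<integral>R. exp (trace (transpose F ** R)) * R $ i $ j \<partial>\<mu>)"
proof -
  have "bounded_linear (\<lambda>M::real^3^3. M $ i $ j)"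
    by (intro bounded_linear_compose[OF bounded_linear_vec_nth bounded_linear_vec_nth])
  from integral_bounded_linear[OF this integrable_fisher_moment[of F]]
  show ?thesis by (simp add: fisher_moment_def)
qed

lemma fisher_moment_svd:
  assumes "U \<in> SO3" "V \<in> SO3"
  shows "fisher_moment (U ** S ** transpose V) = U ** fisher_moment S ** transpose V"
proof -
  have "fisher_moment (U ** S ** transpose V)
      = (\<integral>R. exp (trace (transpose (U ** S ** transpose V) ** (U ** R ** transpose V)))
            *\<^sub>R (U ** R ** transpose V) \<partial>\<mu>)"
    unfolding fisher_moment_def
    by (rule integral_both_mult[symmetric]) (intro continuous_intros assms SO3_transpose)+
  also have "\<dots> = (\<integral>R. U ** (exp (trace (transpose S ** R)) *\<^sub>R R) ** transpose V \<partial>\<mu>)"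
    by (simp add: trace_conjugated assms linear_cmul[OF linear_mult_both])
  also have "\<dots> = U ** fisher_moment S ** transpose V"
    unfolding fisher_moment_def
    by (rule integral_bounded_linear[OF _ integrable_fisher_moment])
       (simp add: linear_mult_both linear_conv_bounded_linear[symmetric])
  finally show ?thesis .
qed

text \<open>
  The half turn \<open>d\<close> about the \<open>i\<close>-th axis commutes with the diagonal parameter, so the moment
  equals its own conjugate by \<open>d\<close>; this conjugation negates the entries \<open>(i, j)\<close> with \<open>j \<noteq> i\<close>.
\<close>
lemma fisher_moment_off_diagonal:
  assumes "i \<noteq> j"
  shows "fisher_moment (diag3 s) $ i $ j = 0"
proof -
  define d :: "real^3" where "d = (\<chi> m. if m = i then 1 else -1)"
  have D: "diag3 d \<in> SO3"
    using exhaust_3[of i] by (auto simp: SO3_iff orthogonal_diag3 det_diag3 d_def)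
  have "diag3 d ** diag3 s ** transpose (diag3 d) = diag3 s"
    by (simp add: transpose_diag3 diag3_mult d_def diag3_eq_iff)
  then have "fisher_moment (diag3 s) = diag3 d ** fisher_moment (diag3 s) ** diag3 d"
    using fisher_moment_svd[OF D D, of "diag3 s"] by (simp add: transpose_diag3)
  then have "fisher_moment (diag3 s) $ i $ j = d $ i * fisher_moment (diag3 s) $ i $ j * d $ j"
    by (metis diag3_mult_both_nth)
  then show ?thesis using assms by (simp add: d_def)
qed

text \<open>
  Dominated convergence along sequences \<open>X\<close> tending to \<open>a\<close>: such a sequence satisfies
  \<open>\<bar>X n - a\<bar> \<le> B\<close> for some \<open>B\<close>, and then the difference quotients are at most
  \<open>\<bar>g\<bar> exp B\<close>, a continuous function on a compact group.
\<close>
lemma deriv_integral_exp: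
  assumes g: "continuous_on UNIV g" and h: "continuous_on UNIV h"
    and bound: "\<And>R. R \<in> SO3 \<Longrightarrow> \<bar>h R\<bar> \<le> 1"
  shows "((\<lambda>t. \<integral>R. g R * exp ((t - a) * h R) \<partial>\<mu>) has_real_derivative (\<integral>R. g R * h R \<partial>\<mu>)) (at a)"
proof -
  let ?q = "\<lambda>t R. (g R * exp ((t - a) * h R) - g R) / (t - a)"
  have int: "integrable \<mu> (\<lambda>R. g R * exp ((t - a) * h R))" "integrable \<mu> g" for t
    by (intro integrable_continuous continuous_intros g h)+
  have quot: "((\<integral>R. g R * exp ((t - a) * h R) \<partial>\<mu>) - (\<integral>R. g R * exp ((a - a) * h R) \<partial>\<mu>)) / (t - a)
      = (\<integral>R. ?q t R \<partial>\<mu>)" for t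
    using int by simp
  have "(\<lambda>n. \<integral>R. ?q (X n) R \<partial>\<mu>) \<longlonglongrightarrow> (\<integral>R. g R * h R \<partial>\<mu>)"
    if X: "\<And>n. X n \<noteq> a" "X \<longlonglongrightarrow> a" for X :: "nat \<Rightarrow> real"
  proof -
    have "Bseq (\<lambda>n. X n - a)"
      using LIM_zero[OF X(2)] by (intro convergent_imp_Bseq convergentI)
    then obtain B where B: "\<And>n. \<bar>X n - a\<bar> \<le> B"
      by (auto simp: Bseq_def)
    show ?thesis
    proof (rule integral_dominated_convergence)
      show "integrable \<mu> (\<lambda>R. \<bar>g R\<bar> * exp B)"
        by (intro integrable_continuous continuous_intros g)
      show "(\<lambda>R. g R * h R) \<in> borel_measurable \<mu>" "?q (X n) \<in> borel_measurable \<mu>" for n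
        using X(1) by (intro measurable_continuous continuous_intros g h; simp)+
      show "AE R in \<mu>. (\<lambda>n. ?q (X n) R) \<longlonglongrightarrow> g R * h R"
      proof (rule AE_I2)
        fix R
        have "((\<lambda>t. g R * exp ((t - a) * h R)) has_real_derivative g R * h R) (at a)"
          by (auto intro!: derivative_eq_intros)
        then have "((\<lambda>t. ?q t R) \<longlongrightarrow> g R * h R) (at a)"
          by (simp add: has_field_derivative_iff)
        then show "(\<lambda>n. ?q (X n) R) \<longlonglongrightarrow> g R * h R"
          using X by (auto simp: tendsto_at_iff_sequentially o_def)
      qed
      show "AE R in \<mu>. norm (?q (X n) R) \<le> \<bar>g R\<bar> * exp B" for n
      proof (rule AE_I2)
        fix R assume "R \<in> space \<mu>"
        then have hR: "\<bar>h R\<bar> \<le> 1" using bound space_haar by simp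
        let ?u = "X n - a"
        have uh: "\<bar>?u * h R\<bar> \<le> \<bar>?u\<bar>" using hR by (simp add: abs_mult mult_left_le)
        have "\<bar>exp (?u * h R) - 1\<bar> \<le> \<bar>?u * h R\<bar> * exp \<bar>?u * h R\<bar>"
          by (rule abs_exp_minus_one_le)
        also have "\<dots> \<le> \<bar>?u\<bar> * exp B"
          using uh B[of n] by (intro mult_mono) auto
        finally have "\<bar>exp (?u * h R) - 1\<bar> / \<bar>?u\<bar> \<le> exp B"
          using X(1)[of n] by (simp add: field_simps)
        then have "\<bar>g R\<bar> * (\<bar>exp (?u * h R) - 1\<bar> / \<bar>?u\<bar>) \<le> \<bar>g R\<bar> * exp B"
          by (intro mult_left_mono) auto
        moreover have "?q (X n) R = g R * ((exp (?u * h R) - 1) / ?u)"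
          by (simp add: algebra_simps diff_divide_distrib)
        ultimately show "norm (?q (X n) R) \<le> \<bar>g R\<bar> * exp B"
          by (simp only: real_norm_def abs_mult abs_divide)
      qed
    qed
  qed
  then show ?thesis
    unfolding has_field_derivative_iff quot
    by (auto simp: tendsto_at_iff_sequentially o_def)
qed

text \<open>The integrand \<open>exp (tr (S R))\<close> depends on \<open>s\<^sub>i\<close> only through the factor \<open>exp (s\<^sub>i R\<^sub>i\<^sub>i)\<close>.\<close>
lemma partial_deriv_fisher_const:
  "partial_deriv i (\<lambda>s. fisher_const \<mu> (diag3 s)) s = fisher_moment (diag3 s) $ i $ i"
proof -
  let ?upd = "\<lambda>t. \<chi> m. if m = i then t else s $ m"
  let ?g = "\<lambda>R. exp (trace (transpose (diag3 s) ** R))"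
  have shift: "trace (transpose (diag3 (?upd t)) ** R)
      = trace (transpose (diag3 s) ** R) + (t - s $ i) * R $ i $ i" for t R
    using exhaust_3[of i] by (auto simp: trace_diag3 sum_3 algebra_simps)
  have "((\<lambda>t. \<integral>R. ?g R * exp ((t - s $ i) * R $ i $ i) \<partial>\<mu>)
      has_real_derivative (\<integral>R. ?g R * R $ i $ i \<partial>\<mu>)) (at (s $ i))"
    by (rule deriv_integral_exp) (intro continuous_intros SO3_entry_le_1; assumption?)+
  then show ?thesis
    unfolding partial_deriv_def fisher_const_def fisher_moment_nth shift exp_add
    by (rule DERIV_imp_deriv)
qed

lemma fisher_moment_diag3:
  "fisher_moment (diag3 s) = diag3 (\<chi> i. partial_deriv i (\<lambda>s. fisher_const \<mu> (diag3 s)) s)"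
  unfolding partial_deriv_fisher_const
  by (auto simp: vec_eq_iff diag3_def[of "vec_lambda _"] fisher_moment_off_diagonal)

lemma first_moment_matrix_fisher:
  assumes "matrix_fisher \<mu> P X F"
  shows "first_moment P X = (1 / fisher_const \<mu> F) *\<^sub>R fisher_moment F"
proof -
  have dist: "distributed P \<mu> X (\<lambda>R. ennreal (1 / fisher_const \<mu> F * exp (trace (transpose F ** R))))"
    using assms by (simp add: matrix_fisher_def)
  have nonneg: "0 \<le> fisher_const \<mu> F"
    unfolding fisher_const_def by simp
  have "(\<integral>\<omega>. X \<omega> $ i $ j \<partial>P) = 1 / fisher_const \<mu> F * fisher_moment F $ i $ j" for i j
  proof -
    have "(\<integral>\<omega>. X \<omega> $ i $ j \<partial>P)
        = (\<integral>R. 1 / fisher_const \<mu> F * exp (trace (transpose F ** R)) * R $ i $ j \<partial>\<mu>)"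
      by (rule distributed_integral[OF dist, symmetric])
         (use nonneg in \<open>auto intro!: measurable_continuous continuous_intros\<close>)
    also have "\<dots> = 1 / fisher_const \<mu> F * fisher_moment F $ i $ j"
      by (simp add: fisher_moment_nth)
    finally show ?thesis .
  qed
  then show ?thesis
    by (simp add: first_moment_def vec_eq_iff)
qed

end

section \<open>Pairs of opposite sigma points\<close>

text \<open>
  Rodrigues' formula.  The cubic relation makes the powers of \<open>K\<close> alternate, up to sign,
  between \<open>K\<close> and \<open>K\<^sup>2\<close>, so the exponential series splits into a sine and a cosine series.
\<close>
lemma rodrigues:
  fixes K :: "real^3^3"
  assumes K: "K ** (K ** K) = - K"
  shows "mat_exp (t *\<^sub>R K) = mat 1 + sin t *\<^sub>R K + (1 - cos t) *\<^sub>R (K ** K)"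
proof -
  have lin: "linear (\<lambda>M::real^3^3. K ** M)"
    using linear_mult_both[of K "mat 1"] by (simp only: matrix_mul_rid)
  have scale: "(t *\<^sub>R K) ** M = t *\<^sub>R (K ** M)" for M :: "real^3^3"
    by (simp add: scalar_matrix_assoc)
  have step: "(t *\<^sub>R K) ** (a *\<^sub>R K - b *\<^sub>R (K ** K) + Z) = t *\<^sub>R (a *\<^sub>R (K ** K) + b *\<^sub>R K)"
    if "K ** Z = 0" for a b Z
    by (simp add: scale linear_add[OF lin] linear_diff[OF lin] linear_cmul[OF lin] K that)
  have kill: "K ** (if n = 0 then mat 1 + K ** K else 0) = 0" for n :: nat
    by (simp add: linear_add[OF lin] K)
  \<comment> \<open>The coefficient series of sine and cosine absorb the factorials; the summand at
    \<open>n = 0\<close> replaces the constant term \<open>- K\<^sup>2\<close> of the cosine part by the identity.\<close>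
  have pow: "((\<lambda>B. (t *\<^sub>R K) ** B) ^^ n) (mat 1) /\<^sub>R fact n
      = (sin_coeff n *\<^sub>R t ^ n) *\<^sub>R K - (cos_coeff n *\<^sub>R t ^ n) *\<^sub>R (K ** K)
        + (if n = 0 then mat 1 + K ** K else 0)" for n
  proof (induction n)
    case (Suc n)
    have "((\<lambda>B. (t *\<^sub>R K) ** B) ^^ Suc n) (mat 1) /\<^sub>R fact (Suc n)
        = ((t *\<^sub>R K) ** (((\<lambda>B. (t *\<^sub>R K) ** B) ^^ n) (mat 1) /\<^sub>R fact n)) /\<^sub>R real (Suc n)"
      by (simp add: scale linear_cmul[OF lin] mult.commute)
    also have "\<dots> = ((t *\<^sub>R K) ** ((sin_coeff n *\<^sub>R t ^ n) *\<^sub>R K - (cos_coeff n *\<^sub>R t ^ n) *\<^sub>R (K ** K)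
        + (if n = 0 then mat 1 + K ** K else 0))) /\<^sub>R real (Suc n)"
      by (simp only: Suc.IH)
    also have "\<dots> = ((sin_coeff n * t ^ Suc n) *\<^sub>R (K ** K) + (cos_coeff n * t ^ Suc n) *\<^sub>R K) /\<^sub>R real (Suc n)"
      unfolding step[OF kill] by (simp add: scaleR_add_right mult_ac)
    also have "\<dots> = (sin_coeff (Suc n) *\<^sub>R t ^ Suc n) *\<^sub>R K - (cos_coeff (Suc n) *\<^sub>R t ^ Suc n) *\<^sub>R (K ** K)"
      by (simp add: sin_coeff_Suc cos_coeff_Suc scaleR_add_right divide_inverse mult_ac)
    finally show ?case by simp
  qed simp
  have "(\<lambda>n. (sin_coeff n *\<^sub>R t ^ n) *\<^sub>R K - (cos_coeff n *\<^sub>R t ^ n) *\<^sub>R (K ** K)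
        + (if n = 0 then mat 1 + K ** K else 0))
      sums (sin t *\<^sub>R K - cos t *\<^sub>R (K ** K) + (mat 1 + K ** K))"
    by (intro sums_add sums_diff sums_scaleR_left sin_converges cos_converges)
       (use sums_single[of 0 "\<lambda>_. mat 1 + K ** K"] in simp)
  then have "mat_exp (t *\<^sub>R K) = sin t *\<^sub>R K - cos t *\<^sub>R (K ** K) + (mat 1 + K ** K)"
    unfolding mat_exp_def pow by (rule sums_unique[symmetric])
  then show ?thesis by (simp add: scaleR_diff_left)
qed

lemma hat_axis_sq:
  "hat (axis i 1) ** hat (axis i 1) = diag3 (\<chi> m. if m = i then 0 else - 1)"
  using exhaust_3[of i]
  by (auto simp: hat_def matrix_def cross3_def diag3_def matrix_matrix_mult_def vec_eq_iff
      forall_3 sum_3 axis_def)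

lemma hat_axis_cube: "hat (axis i 1) ** (hat (axis i 1) ** hat (axis i 1)) = - hat (axis i 1)"
  unfolding hat_axis_sq using exhaust_3[of i]
  by (auto simp: hat_def matrix_def cross3_def diag3_def matrix_matrix_mult_def vec_eq_iff
      forall_3 sum_3 axis_def)

lemma mat_exp_hat_pair:
  "mat_exp (t *\<^sub>R hat (axis i 1)) + mat_exp ((- t) *\<^sub>R hat (axis i 1))
     = diag3 (\<chi> m. if m = i then 2 else 2 * cos t)"
  unfolding rodrigues[OF hat_axis_cube] hat_axis_sq
  by (simp add: vec_eq_iff diag3_def mat_def)

section \<open>Equality of the first moments\<close>

theorem mainTheorem9:
  fixes \<mu> :: "(real^3^3) measure" and P :: "'a measure" and X :: "'a \<Rightarrow> real^3^3"
    and F U V :: "real^3^3" and s :: "real^3" and \<sigma> :: real and \<theta> :: "3 \<Rightarrow> real"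
  assumes "is_haar_SO3 \<mu>"
    and "matrix_fisher \<mu> P X F"
    and "proper_svd F U s V"
    and "ut_parameter s \<sigma>"
    and "ut_angles \<mu> s \<sigma> \<theta>"
  shows "(\<Sum>(R, w)\<leftarrow>unscented_transform \<mu> U s V \<theta>. w *\<^sub>R R) = first_moment P X"
proof -
  interpret haar_SO3 \<mu> by standard (rule assms(1))
  note svd = proper_svd_SO3[OF assms(3)]
  define c where "c = fisher_const \<mu> (diag3 s)"
  define p where "p i = partial_deriv i (\<lambda>s. fisher_const \<mu> (diag3 s)) s" for i
  define w where "w = ut_weight \<mu> s \<theta>"
  define w0 where "w0 = 1 - 2 * (w (1,2,3) + w (2,3,1) + w (3,1,2))"
  define T where "T M = U ** M ** transpose V" for M
  define E where "E i t = mat_exp (t *\<^sub>R hat (axis i 1))" for i t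
  define M where "M = w0 *\<^sub>R mat 1 + w (1,2,3) *\<^sub>R (E 1 (\<theta> 1) + E 1 (- \<theta> 1))
    + w (2,3,1) *\<^sub>R (E 2 (\<theta> 2) + E 2 (- \<theta> 2)) + w (3,1,2) *\<^sub>R (E 3 (\<theta> 3) + E 3 (- \<theta> 3))"
  have lin: "linear T"
    unfolding T_def by (rule linear_mult_both)
  have "(\<Sum>(R, w)\<leftarrow>unscented_transform \<mu> U s V \<theta>. w *\<^sub>R R) = T M"
    unfolding M_def linear_add[OF lin] linear_cmul[OF lin]
    by (simp add: unscented_transform_def sigma_point_def Let_def w_def w0_def T_def E_def
        scaleR_add_right)
  also have "M = diag3 (\<chi> i. 1 / c * p i)"
  proof -
    have "cos (\<theta> i) < 1" for i
    proof -
      have "0 < \<theta> i" "\<theta> i < pi"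
        using assms(5) exhaust_3[of i] by (auto simp: ut_angles_def cyclic_triples_def)
      then show ?thesis using cos_monotone_0_pi[of 0 "\<theta> i"] by simp
    qed
    then have ne: "1 - cos (\<theta> i) \<noteq> 0" for i
      by (metis less_irrefl right_minus_eq)
    have weight: "w (i, j, k) * (1 - cos (\<theta> i)) = (1 / c * (p i - p j - p k) + 1) / 4" for i j k
      using ne[of i] by (simp add: w_def ut_weight_def Let_def c_def p_def divide_simps)
    \<comment> \<open>The total weight one is the leading \<open>1\<close>; the pair of sigma points about the \<open>i\<close>-th axis
      affects only the diagonal entries other than the \<open>i\<close>-th.\<close>
    have entry: "M = diag3 (\<chi> m. 1 - 2 * ((if m = 1 then 0 else w (1,2,3) * (1 - cos (\<theta> 1)))
        + (if m = 2 then 0 else w (2,3,1) * (1 - cos (\<theta> 2)))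
        + (if m = 3 then 0 else w (3,1,2) * (1 - cos (\<theta> 3)))))"
      unfolding M_def E_def mat_exp_hat_pair w0_def
      by (simp add: vec_eq_iff forall_3 diag3_def mat_def algebra_simps)
    show ?thesis
      unfolding entry weight by (simp add: vec_eq_iff forall_3 diag3_def algebra_simps add_divide_distrib diff_divide_distrib)
  qed
  also have "diag3 (\<chi> i. 1 / c * p i) = (1 / c) *\<^sub>R fisher_moment (diag3 s)"
    unfolding fisher_moment_diag3 p_def by (simp add: diag3_def[of "vec_lambda _"] vec_eq_iff)
  also have "T \<dots> = (1 / c) *\<^sub>R fisher_moment F"
    by (simp only: linear_cmul[OF lin]) (simp add: T_def svd fisher_moment_svd)
  also have "\<dots> = first_moment P X"
    by (simp add: first_moment_matrix_fisher[OF assms(2)] c_def svd fisher_const_svd)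
  finally show ?thesis .
qed

end
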